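(* Let $\hat P$ be the signed Petersen graph with vertices $v_1,\dots,v_5,u_1,\dots,u_5$, whose positive edges are $v_1v_2,v_2v_3,v_3v_4,v_4v_5,v_5v_1$ and $v_iu_i$ for $1\le i\le 5$, and whose negative edges are $u_1u_3,u_3u_5,u_5u_2,u_2u_4,u_4u_1$. Then $\hat P$ is $C_3^*$-critical.
   Context: All graphs are finite and may have multiple edges or loops. A signed graph $(G,\sigma)$ is a graph $G$ together with a signature $\sigma:E(G)\to\{+,-\}$. A digon is a pair of parallel edges with different signs. A subgraph of a signed graph carries the restricted signature. The sign of a closed walk is the product of the signs of its edges (with repetition). A homomorphism of $(G,\sigma)$ to $(H,\pi)$ is a mapping $V(G)\to V(H)$ that preserves adjacency and the signs of all closed walks; write $(G,\sigma)\to(H,\pi)$ if one exists. $C_3^*$ is the signed graph on three vertices consisting of a triangle with all three edges positive, together with a negative loop at each vertex. A signed graph $\hat G$ is $C_3^*$-critical if it has no digon and no positive loop, $\hat G\not\to C_3^*$, and $\hat G'\to C_3^*$ for every proper subgraph $\hat G'$ of $\hat G$. *)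

theory Defs
  imports Main "HOL-Library.Uprod"
begin

text \<open>Unordered pairs may be degenerate, so \<open>Upair x x\<close> is the pair of ends of a loop at
  \<open>x\<close>. The signs + and - are the integers 1 and -1.\<close>

record ('v, 'e) sgraph =
  verts :: "'v set"
  edges :: "'e set"
  ends :: "'e \<Rightarrow> 'v uprod"
  sign :: "'e \<Rightarrow> int"

definition signed_graph :: "('v, 'e) sgraph \<Rightarrow> bool" where
  "signed_graph G \<longleftrightarrow> finite (verts G) \<and> finite (edges G) \<and>
     (\<forall>e\<in>edges G. set_uprod (ends G e) \<subseteq> verts G) \<and>
     (\<forall>e\<in>edges G. sign G e = 1 \<or> sign G e = -1)"

text \<open>A walk is given by its first vertex and its list of edges, which together determine the
  remaining vertices.\<close>

fun walk :: "('v, 'e) sgraph \<Rightarrow> 'v \<Rightarrow> 'e list \<Rightarrow> 'v \<Rightarrow> bool" where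
  "walk G x [] y \<longleftrightarrow> x \<in> verts G \<and> x = y"
| "walk G x (e # es) y \<longleftrightarrow> e \<in> edges G \<and> (\<exists>z. ends G e = Upair x z \<and> walk G z es y)"

definition closed_walk :: "('v, 'e) sgraph \<Rightarrow> 'v \<Rightarrow> 'e list \<Rightarrow> bool" where
  "closed_walk G x es \<longleftrightarrow> walk G x es x"

definition walk_sign :: "('v, 'e) sgraph \<Rightarrow> 'e list \<Rightarrow> int" where
  "walk_sign G es = prod_list (map (sign G) es)"

text \<open>The image of a walk under a vertex map is only determined once every edge has been assigned
  an edge joining the images of its ends; hence the edge map \<open>g\<close>. If the target has no parallel
  edges, as is the case for \<open>C3star\<close> below, \<open>g\<close> is determined by \<open>f\<close>.\<close>

definition signed_hom ::
  "('v, 'e) sgraph \<Rightarrow> ('w, 'd) sgraph \<Rightarrow> ('v \<Rightarrow> 'w) \<Rightarrow> ('e \<Rightarrow> 'd) \<Rightarrow> bool" where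
  "signed_hom G H f g \<longleftrightarrow>
     (\<forall>x\<in>verts G. f x \<in> verts H) \<and>
     (\<forall>e\<in>edges G. g e \<in> edges H \<and> ends H (g e) = map_uprod f (ends G e)) \<and>
     (\<forall>x es. closed_walk G x es \<longrightarrow> walk_sign H (map g es) = walk_sign G es)"

definition hom_exists :: "('v, 'e) sgraph \<Rightarrow> ('w, 'd) sgraph \<Rightarrow> bool" where
  "hom_exists G H \<longleftrightarrow> (\<exists>f g. signed_hom G H f g)"

definition subgraph :: "('v, 'e) sgraph \<Rightarrow> ('v, 'e) sgraph \<Rightarrow> bool" where
  "subgraph H G \<longleftrightarrow> signed_graph H \<and> verts H \<subseteq> verts G \<and> edges H \<subseteq> edges G \<and>
     (\<forall>e\<in>edges H. ends H e = ends G e \<and> sign H e = sign G e)"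

definition proper_subgraph :: "('v, 'e) sgraph \<Rightarrow> ('v, 'e) sgraph \<Rightarrow> bool" where
  "proper_subgraph H G \<longleftrightarrow> subgraph H G \<and> (verts H \<noteq> verts G \<or> edges H \<noteq> edges G)"

definition has_digon :: "('v, 'e) sgraph \<Rightarrow> bool" where
  "has_digon G \<longleftrightarrow> (\<exists>e\<in>edges G. \<exists>e'\<in>edges G. ends G e = ends G e' \<and> sign G e \<noteq> sign G e')"

definition has_positive_loop :: "('v, 'e) sgraph \<Rightarrow> bool" where
  "has_positive_loop G \<longleftrightarrow> (\<exists>e\<in>edges G. \<exists>x. ends G e = Upair x x \<and> sign G e = 1)"

definition critical :: "('w, 'd) sgraph \<Rightarrow> ('v, 'e) sgraph \<Rightarrow> bool" where
  "critical H G \<longleftrightarrow> signed_graph G \<and> \<not> has_digon G \<and> \<not> has_positive_loop G \<and>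
     \<not> hom_exists G H \<and> (\<forall>G'. proper_subgraph G' G \<longrightarrow> hom_exists G' H)"

text \<open>The signed graph with positive edges \<open>P\<close> and negative edges \<open>N\<close>, each edge being its pair
  of ends tagged with its sign.\<close>

definition sgraph_of ::
  "'v set \<Rightarrow> 'v uprod set \<Rightarrow> 'v uprod set \<Rightarrow> ('v, 'v uprod \<times> int) sgraph" where
  "sgraph_of V P N =
     \<lparr>verts = V, edges = (\<lambda>p. (p, 1)) ` P \<union> (\<lambda>p. (p, -1)) ` N, ends = fst, sign = snd\<rparr>"

definition C3star :: "(nat, nat uprod \<times> int) sgraph" where
  "C3star = sgraph_of {0, 1, 2}
     {Upair 0 1, Upair 1 2, Upair 2 0}
     {Upair 0 0, Upair 1 1, Upair 2 2}"

datatype petersen_vertex = V nat | U nat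

definition signed_petersen :: "(petersen_vertex, petersen_vertex uprod \<times> int) sgraph" where
  "signed_petersen = sgraph_of (V ` {1..5} \<union> U ` {1..5})
     ({Upair (V 1) (V 2), Upair (V 2) (V 3), Upair (V 3) (V 4), Upair (V 4) (V 5),
       Upair (V 5) (V 1)} \<union> {Upair (V i) (U i) | i. 1 \<le> i \<and> i \<le> 5})
     {Upair (U 1) (U 3), Upair (U 3) (U 5), Upair (U 5) (U 2), Upair (U 2) (U 4),
      Upair (U 4) (U 1)}"

lemma signed_graph_C3star: "signed_graph C3star"
  by (auto simp: signed_graph_def C3star_def sgraph_of_def)

end

theory Submission imports Defs
begin

text \<open>A map to \<open>C3star\<close> preserves the signs of closed walks iff every closed walk has as many
  negative edges, modulo 2, as edges whose two ends have the same image.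

  For non-existence, the positive pentagon \<open>V 1, \<dots>, V 5\<close> and the five negative pentagons
  \<open>V i, V (i+1), V (i+2), U (i+2), U i\<close> suffice, as they span the cycle space. A 3-colouring of the
  outer pentagon with an even number of monochromatic edges is, up to rotation, of the form
  \<open>xyxyz\<close>, \<open>xxxyz\<close> or \<open>xxyyz\<close>, and none of these extends to the inner vertices.

  For criticality it is enough to delete single edges. Rotation leaves three kinds of edges, and for
  each a homomorphism is given together with a switching that turns exactly the monochromatic edges
  negative.\<close>

section \<open>Maps to \<open>C3star\<close> from switched labellings\<close>

text \<open>A label \<open>\<plusminus>k\<close> stands for the vertex \<open>k - 1\<close> of \<open>C3star\<close> together with a switching sign.\<close>

definition compat :: "int \<Rightarrow> int \<Rightarrow> int \<Rightarrow> bool" where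
  "compat s a b \<longleftrightarrow> s * sgn a * sgn b = (if \<bar>a\<bar> = \<bar>b\<bar> then -1 else 1)"

lemma compat_commute: "compat s a b \<longleftrightarrow> compat s b a"
  by (auto simp: compat_def mult_ac)

lemma C3star_edge:
  assumes "a \<in> {0, 1, 2}" "b \<in> {0, 1, 2}"
  shows "(Upair a b, if a = b then -1 else 1) \<in> edges C3star"
  using assms by (auto simp: C3star_def sgraph_of_def)

lemma sign_C3star:
  assumes "d \<in> edges C3star" "ends C3star d = Upair a b"
  shows "sign C3star d = (if a = b then -1 else 1)"
  using assms by (auto simp: C3star_def sgraph_of_def)

text \<open>In the sign of the image of a walk, the switching sign of each inner vertex occurs twice
  and cancels; on a closed walk those of the two ends cancel as well.\<close>

lemma hom_C3star_if_labelling: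
  fixes L :: "'v \<Rightarrow> int"
  assumes G: "signed_graph G"
    and range: "\<And>x. x \<in> verts G \<Longrightarrow> \<bar>L x\<bar> \<in> {1, 2, 3}"
    and compat: "\<And>e. e \<in> edges G \<Longrightarrow>
      \<exists>x y. ends G e = Upair x y \<and> compat (sign G e) (L x) (L y)"
  shows "hom_exists G C3star"
proof -
  define f where "f x = nat (\<bar>L x\<bar> - 1)" for x
  define g where "g e = (map_uprod f (ends G e),
    if proper_uprod (map_uprod f (ends G e)) then 1 else -1 :: int)" for e
  have f_range: "f x \<in> {0, 1, 2}" if "x \<in> verts G" for x
    using range[OF that] by (auto simp: f_def)
  have f_eq: "f x = f y \<longleftrightarrow> \<bar>L x\<bar> = \<bar>L y\<bar>" if "x \<in> verts G" "y \<in> verts G" for x y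
    using range[OF that(1)] range[OF that(2)] by (auto simp: f_def)
  have sgn2: "sgn (L x) * sgn (L x) = 1" if "x \<in> verts G" for x
    using range[OF that] by (auto simp: sgn_if)
  have ends_verts: "x \<in> verts G \<and> y \<in> verts G" if "e \<in> edges G" "ends G e = Upair x y" for e x y
    using G that by (fastforce simp: signed_graph_def)
  have sign_g: "sign C3star (g e) = sign G e * sgn (L x) * sgn (L y)"
    if "e \<in> edges G" "ends G e = Upair x y" for e x y
  proof -
    have "compat (sign G e) (L x) (L y)"
      using compat[OF that(1)] that(2) compat_commute by auto
    with f_eq[of x y] ends_verts[OF that] show ?thesis
      by (simp add: compat_def g_def that C3star_def sgraph_of_def)
  qed
  have walk: "y \<in> verts G \<and>
      walk_sign C3star (map g es) = walk_sign G es * sgn (L x) * sgn (L y)"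
    if "walk G x es y" for x es y
    using that
  proof (induction es arbitrary: x)
    case Nil
    then show ?case using sgn2[of y] by (auto simp: walk_sign_def mult.assoc)
  next
    case (Cons e es)
    then obtain z where e: "e \<in> edges G" "ends G e = Upair x z" and w: "walk G z es y"
      by auto
    from ends_verts[OF e] have z: "sgn (L z) * sgn (L z) = 1" using sgn2[of z] by blast
    have "walk_sign C3star (map g (e # es)) =
        sign G e * sgn (L x) * walk_sign G es * sgn (L y) * (sgn (L z) * sgn (L z))"
      using Cons.IH[OF w] sign_g[OF e] by (simp add: walk_sign_def mult_ac)
    with Cons.IH[OF w] z show ?case by (simp add: walk_sign_def mult_ac)
  qed
  have "g e \<in> edges C3star \<and> ends C3star (g e) = map_uprod f (ends G e)" if e: "e \<in> edges G" for e
  proof -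
    obtain x y where xy: "ends G e = Upair x y" by (cases "ends G e")
    have "(if f x = f y then -1 else 1) = (if f x \<noteq> f y then 1 else -1 :: int)" by simp
    with C3star_edge[of "f x" "f y"] f_range ends_verts[OF e xy] have "g e \<in> edges C3star"
      by (simp add: g_def xy)
    then show ?thesis by (simp add: C3star_def sgraph_of_def g_def)
  qed
  moreover have "walk_sign C3star (map g es) = walk_sign G es" if "closed_walk G x es" for x es
    using walk[of x es x] that sgn2[of x] by (simp add: closed_walk_def mult.assoc)
  ultimately have "signed_hom G C3star f g"
    using f_range by (auto simp: signed_hom_def C3star_def sgraph_of_def)
  then show ?thesis by (auto simp: hom_exists_def)
qed

lemma verts_petersen: "verts signed_petersen = V ` {1..5} \<union> U ` {1..5}"
  by (simp add: signed_petersen_def sgraph_of_def)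

lemma ends_petersen [simp]: "ends signed_petersen = fst"
  and sign_petersen [simp]: "sign signed_petersen = snd"
  by (simp_all add: signed_petersen_def sgraph_of_def)

lemma edges_petersen:
  "edges signed_petersen =
    {(Upair (V 1) (V 2), 1), (Upair (V 2) (V 3), 1), (Upair (V 3) (V 4), 1),
     (Upair (V 4) (V 5), 1), (Upair (V 5) (V 1), 1),
     (Upair (V 1) (U 1), 1), (Upair (V 2) (U 2), 1), (Upair (V 3) (U 3), 1),
     (Upair (V 4) (U 4), 1), (Upair (V 5) (U 5), 1),
     (Upair (U 1) (U 3), -1), (Upair (U 3) (U 5), -1), (Upair (U 5) (U 2), -1),
     (Upair (U 2) (U 4), -1), (Upair (U 4) (U 1), -1)}"
proof -
  have "{Upair (V i) (U i) | i. 1 \<le> i \<and> i \<le> 5} = (\<lambda>i. Upair (V i) (U i)) ` {1..5}"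
    by auto
  also have "{1..5} = {1, 2, 3, 4, 5 :: nat}" by auto
  finally show ?thesis
    unfolding signed_petersen_def sgraph_of_def by (simp add: insert_commute)
qed

lemma signed_graph_petersen: "signed_graph signed_petersen"
  unfolding signed_graph_def by (simp add: edges_petersen verts_petersen)

section \<open>Labellings after the deletion of an edge\<close>

text \<open>Indices are taken modulo 5, so the head of each list belongs to the vertex with index 5
  when \<open>k = 0\<close>.\<close>

fun label :: "int list \<Rightarrow> int list \<Rightarrow> nat \<Rightarrow> petersen_vertex \<Rightarrow> int" where
  "label vs us k (V i) = vs ! ((i + k) mod 5)"
| "label vs us k (U i) = us ! ((i + k) mod 5)"

lemma label_range:
  assumes "length vs = 5" "length us = 5" "\<And>a. a \<in> set vs \<union> set us \<Longrightarrow> \<bar>a\<bar> \<in> {1, 2, 3}"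
  shows "\<bar>label vs us k x\<bar> \<in> {1, 2, 3}"
  using assms by (cases x) (simp_all del: insert_iff)

definition compat_edge :: "(petersen_vertex \<Rightarrow> int) \<Rightarrow> petersen_vertex uprod \<times> int \<Rightarrow> bool" where
  "compat_edge L e \<longleftrightarrow> (\<exists>x y. fst e = Upair x y \<and> compat (snd e) (L x) (L y))"

lemma compat_edge_Pair [simp]: "compat_edge L (Upair x y, s) \<longleftrightarrow> compat s (L x) (L y)"
  unfolding compat_edge_def using compat_commute by auto

text \<open>For an outer edge or a spoke, the inner pentagon goes to one negative loop. Two other
  colours must clash on the odd outer cycle; recolouring an end of the clash moves it to a spoke.
  For an inner edge, one inner vertex is switched to suit its monochromatic spoke.\<close>

lemma petersen_delete_edge_labelling:
  assumes "e \<in> edges signed_petersen"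
  shows "\<exists>L. (\<forall>x. \<bar>L x\<bar> \<in> {1, 2, 3}) \<and> (\<forall>e' \<in> edges signed_petersen - {e}. compat_edge L e')"
proof -
  \<comment> \<open>For \<open>k = 0\<close> these violate only \<open>V 5 V 1\<close>, \<open>V 5 U 5\<close> and \<open>U 5 U 2\<close>, respectively.\<close>
  define A where "A = label [2, 2, 3, 2, 3] [1, 1, 1, 1, 1]"
  define B where "B = label [1, 2, 3, 2, 3] [1, 1, 1, 1, 1]"
  define C where "C = label [2, 3, 1, 2, 1] [1, -3, 2, 1, 2]"
  have range: "\<bar>A k x\<bar> \<in> {1, 2, 3}" "\<bar>B k x\<bar> \<in> {1, 2, 3}" "\<bar>C k x\<bar> \<in> {1, 2, 3}" for k x
    unfolding A_def B_def C_def by (rule label_range; force)+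
  \<comment> \<open>Varying \<open>k\<close> rotates the exceptional edge through all five of its
    kind.\<close>
  have "\<exists>L\<in>{A, B, C}. \<exists>k\<in>{0, 1, 2, 3, 4}. \<forall>e' \<in> edges signed_petersen. e' = e \<or> compat_edge (L k) e'"
    using assms unfolding edges_petersen
    by (elim insertE emptyE; simp add: A_def B_def C_def compat_def)
  with range show ?thesis by blast
qed

section \<open>The parity obstruction\<close>

text \<open>The arguments are the images of \<open>V 1, \<dots>, V 5, U 1, \<dots>, U 5\<close>; a chain of \<open>\<noteq>\<close> is an exclusive
  or, so each conjunct gives the parity of the monochromatic edges of one pentagon.\<close>

definition petersen_parity :: "'a \<Rightarrow> 'a \<Rightarrow> 'a \<Rightarrow> 'a \<Rightarrow> 'a \<Rightarrow> 'a \<Rightarrow> 'a \<Rightarrow> 'a \<Rightarrow> 'a \<Rightarrow> 'a \<Rightarrow> bool" where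
  "petersen_parity v1 v2 v3 v4 v5 u1 u2 u3 u4 u5 \<longleftrightarrow>
    \<not> ((v1 = v2) \<noteq> ((v2 = v3) \<noteq> ((v3 = v4) \<noteq> ((v4 = v5) \<noteq> (v5 = v1))))) \<and>
    (v1 = v2) \<noteq> ((v2 = v3) \<noteq> ((v3 = u3) \<noteq> ((u3 = u1) \<noteq> (u1 = v1)))) \<and>
    (v2 = v3) \<noteq> ((v3 = v4) \<noteq> ((v4 = u4) \<noteq> ((u4 = u2) \<noteq> (u2 = v2)))) \<and>
    (v3 = v4) \<noteq> ((v4 = v5) \<noteq> ((v5 = u5) \<noteq> ((u5 = u3) \<noteq> (u3 = v3)))) \<and>
    (v4 = v5) \<noteq> ((v5 = v1) \<noteq> ((v1 = u1) \<noteq> ((u1 = u4) \<noteq> (u4 = v4)))) \<and>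
    (v5 = v1) \<noteq> ((v1 = v2) \<noteq> ((v2 = u2) \<noteq> ((u2 = u5) \<noteq> (u5 = v5))))"

lemma petersen_parity_rotate:
  "petersen_parity v1 v2 v3 v4 v5 u1 u2 u3 u4 u5 \<Longrightarrow> petersen_parity v2 v3 v4 v5 v1 u2 u3 u4 u5 u1"
  unfolding petersen_parity_def by argo

text \<open>With the outer colours fixed, each odd pentagon restricts one pair of neighbours on the
  inner pentagon; none of the 243 inner colourings meets all five restrictions.\<close>

lemma not_petersen_parity_patterns:
  assumes ne: "x \<noteq> y" "y \<noteq> z" "x \<noteq> z" and u: "{u1, u2, u3, u4, u5} \<subseteq> {x, y, z}"
  shows "\<not> petersen_parity x y x y z u1 u2 u3 u4 u5"
    and "\<not> petersen_parity x x x y z u1 u2 u3 u4 u5"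
    and "\<not> petersen_parity x x y y z u1 u2 u3 u4 u5"
proof -
  have u': "u1 = x \<or> u1 = y \<or> u1 = z" "u3 = x \<or> u3 = y \<or> u3 = z" "u5 = x \<or> u5 = y \<or> u5 = z"
    "u2 = x \<or> u2 = y \<or> u2 = z" "u4 = x \<or> u4 = y \<or> u4 = z"
    using u by auto
  show "\<not> petersen_parity x y x y z u1 u2 u3 u4 u5"
    and "\<not> petersen_parity x x x y z u1 u2 u3 u4 u5"
    and "\<not> petersen_parity x x y y z u1 u2 u3 u4 u5"
    unfolding petersen_parity_def using u' by (elim disjE; simp add: ne ne[symmetric])+
qed

text \<open>With at most two colours, the outer pentagon has an even number of colour changes, so an
  odd number of monochromatic edges. Even parity thus forces three colours and three or five
  changes, which leaves only the patterns.\<close>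

lemma not_petersen_parity:
  assumes A: "card A = 3" and range: "{v1, v2, v3, v4, v5, u1, u2, u3, u4, u5} \<subseteq> A"
  shows "\<not> petersen_parity v1 v2 v3 v4 v5 u1 u2 u3 u4 u5"
proof
  assume par: "petersen_parity v1 v2 v3 v4 v5 u1 u2 u3 u4 u5"
  \<comment> \<open>In all three patterns the first, fourth and fifth entries are distinct; only
    \<open>b\<close> and \<open>c\<close> vary.\<close>
  have no_pattern: "\<not> (x \<noteq> y \<and> y \<noteq> z \<and> x \<noteq> z \<and>
      (b = y \<and> c = x \<or> b = x \<and> c = x \<or> b = x \<and> c = y))"
    if "petersen_parity x b c y z p q r s t" "{x, b, c, y, z, p, q, r, s, t} \<subseteq> A"
    for x b c y z p q r s t
  proof
    assume *: "x \<noteq> y \<and> y \<noteq> z \<and> x \<noteq> z \<and>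
      (b = y \<and> c = x \<or> b = x \<and> c = x \<or> b = x \<and> c = y)"
    \<comment> \<open>Three distinct elements exhaust \<open>A\<close>, so the inner colours are
      among them too.\<close>
    have "finite A" using A by (auto intro: card_ge_0_finite)
    then have "A = {x, y, z}"
      using card_subset_eq[of A "{x, y, z}"] A * that(2) by auto
    then show False
      using not_petersen_parity_patterns[of x y z p q r s t] * that by auto
  qed
  note par' = petersen_parity_rotate[OF par]
  note par'' = petersen_parity_rotate[OF par']
  note par''' = petersen_parity_rotate[OF par'']
  note par'''' = petersen_parity_rotate[OF par''']
  have no:
    "\<not> (v1 \<noteq> v4 \<and> v4 \<noteq> v5 \<and> v1 \<noteq> v5 \<and> (v2 = v4 \<and> v3 = v1 \<or> v2 = v1 \<and> v3 = v1 \<or> v2 = v1 \<and> v3 = v4))"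
    "\<not> (v2 \<noteq> v5 \<and> v5 \<noteq> v1 \<and> v2 \<noteq> v1 \<and> (v3 = v5 \<and> v4 = v2 \<or> v3 = v2 \<and> v4 = v2 \<or> v3 = v2 \<and> v4 = v5))"
    "\<not> (v3 \<noteq> v1 \<and> v1 \<noteq> v2 \<and> v3 \<noteq> v2 \<and> (v4 = v1 \<and> v5 = v3 \<or> v4 = v3 \<and> v5 = v3 \<or> v4 = v3 \<and> v5 = v1))"
    "\<not> (v4 \<noteq> v2 \<and> v2 \<noteq> v3 \<and> v4 \<noteq> v3 \<and> (v5 = v2 \<and> v1 = v4 \<or> v5 = v4 \<and> v1 = v4 \<or> v5 = v4 \<and> v1 = v2))"
    "\<not> (v5 \<noteq> v3 \<and> v3 \<noteq> v4 \<and> v5 \<noteq> v4 \<and> (v1 = v3 \<and> v2 = v5 \<or> v1 = v5 \<and> v2 = v5 \<or> v1 = v5 \<and> v2 = v3))"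
    using par par' par'' par''' par'''' range by - (rule no_pattern, assumption, blast)+
  obtain x y z where xyz: "A = {x, y, z}" and ne: "x \<noteq> y" "y \<noteq> z" "x \<noteq> z"
    using A by (auto simp: card_3_iff)
  then have v: "v1 = x \<or> v1 = y \<or> v1 = z" "v2 = x \<or> v2 = y \<or> v2 = z" "v3 = x \<or> v3 = y \<or> v3 = z"
    "v4 = x \<or> v4 = y \<or> v4 = z" "v5 = x \<or> v5 = y \<or> v5 = z"
    using range by auto
  have "\<not> ((v1 = v2) \<noteq> ((v2 = v3) \<noteq> ((v3 = v4) \<noteq> ((v4 = v5) \<noteq> (v5 = v1)))))"
    using par unfolding petersen_parity_def by (rule conjunct1)
  then show False
    using no v by (elim disjE; simp add: ne ne[symmetric])
qed

text \<open>An edge of \<open>C3star\<close> is negative exactly when it is a loop, so the sign of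
  the image walk is the parity of the monochromatic edges.\<close>

lemma hom_C3star_pentagon:
  assumes hom: "signed_hom G C3star f g" and "a \<in> verts G"
    and e: "{e1, e2, e3, e4, e5} \<subseteq> edges G"
    and ends: "ends G e1 = Upair a b" "ends G e2 = Upair b c" "ends G e3 = Upair c d"
      "ends G e4 = Upair d e" "ends G e5 = Upair e a"
  shows "((f a = f b) \<noteq> ((f b = f c) \<noteq> ((f c = f d) \<noteq> ((f d = f e) \<noteq> (f e = f a))))) \<longleftrightarrow>
    sign G e1 * sign G e2 * sign G e3 * sign G e4 * sign G e5 = -1"
proof -
  have sign_g: "sign C3star (g e') = (if f x = f y then -1 else 1)"
    if "e' \<in> edges G" "ends G e' = Upair x y" for e' x y
    using hom that by (intro sign_C3star) (auto simp: signed_hom_def)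
  have "closed_walk G a [e1, e2, e3, e4, e5]"
    using assms by (auto simp: closed_walk_def)
  with hom have "walk_sign C3star (map g [e1, e2, e3, e4, e5]) = walk_sign G [e1, e2, e3, e4, e5]"
    unfolding signed_hom_def by blast
  with e ends show ?thesis
    by (simp add: walk_sign_def sign_g[OF _ ends(1)] sign_g[OF _ ends(2)] sign_g[OF _ ends(3)]
        sign_g[OF _ ends(4)] sign_g[OF _ ends(5)] split: if_splits)
qed

lemma not_hom_exists_petersen_C3star: "\<not> hom_exists signed_petersen C3star"
proof
  assume "hom_exists signed_petersen C3star"
  then obtain f g where hom: "signed_hom signed_petersen C3star f g"
    by (auto simp: hom_exists_def)
  have range: "f (V i) \<in> {0, 1, 2}" "f (U i) \<in> {0, 1, 2}" if "i \<in> {1..5}" for i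
    using hom that by (auto simp: signed_hom_def C3star_def sgraph_of_def verts_petersen)
  have pentagon: "((f a = f b) \<noteq> ((f b = f c) \<noteq> ((f c = f d) \<noteq> ((f d = f e) \<noteq> (f e = f a))))) \<longleftrightarrow>
      s1 * s2 * s3 * s4 * s5 = -1"
    if "a \<in> verts signed_petersen"
      "{(Upair a b, s1), (Upair b c, s2), (Upair c d, s3), (Upair d e, s4), (Upair e a, s5)}
        \<subseteq> edges signed_petersen" for a b c d e s1 s2 s3 s4 s5
    using hom_C3star_pentagon[OF hom that] by simp
  \<comment> \<open>The signs are fixed here because the left-hand side to be rewritten does not
    mention them. Each odd pentagon has its only negative edge, the inner one, in fourth
    place.\<close>
  note even = pentagon[where ?s1.0 = 1 and ?s2.0 = 1 and ?s3.0 = 1 and ?s4.0 = 1 and ?s5.0 = 1]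
    and odd = pentagon[where ?s1.0 = 1 and ?s2.0 = 1 and ?s3.0 = 1 and ?s4.0 = "-1" and ?s5.0 = 1]
  have "petersen_parity (f (V 1)) (f (V 2)) (f (V 3)) (f (V 4)) (f (V 5))
      (f (U 1)) (f (U 2)) (f (U 3)) (f (U 4)) (f (U 5))"
    unfolding petersen_parity_def
    by (intro conjI, (subst even; simp add: verts_petersen edges_petersen),
      (subst odd; simp add: verts_petersen edges_petersen)+)
  moreover have "\<not> petersen_parity (f (V 1)) (f (V 2)) (f (V 3)) (f (V 4)) (f (V 5))
      (f (U 1)) (f (U 2)) (f (U 3)) (f (U 4)) (f (U 5))"
    by (rule not_petersen_parity[of "{0, 1, 2}"]) (use range in simp_all)
  ultimately show False by contradiction
qed

theorem lemma4p1: "critical C3star signed_petersen"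
  unfolding critical_def
proof (intro conjI allI impI)
  show "signed_graph signed_petersen" by (rule signed_graph_petersen)
  show "\<not> has_digon signed_petersen"
    by (simp add: has_digon_def edges_petersen)
  show "\<not> has_positive_loop signed_petersen"
    by (simp add: has_positive_loop_def edges_petersen)
  show "\<not> hom_exists signed_petersen C3star" by (rule not_hom_exists_petersen_C3star)
next
  fix H
  assume "proper_subgraph H signed_petersen"
  then have H: "signed_graph H" "verts H \<subseteq> verts signed_petersen"
    "edges H \<subseteq> edges signed_petersen"
    "\<And>e. e \<in> edges H \<Longrightarrow> ends H e = fst e \<and> sign H e = snd e"
    and proper: "verts H \<noteq> verts signed_petersen \<or> edges H \<noteq> edges signed_petersen"
    by (auto simp: proper_subgraph_def subgraph_def)
  \<comment> \<open>There are no isolated vertices, so a subgraph with all edges has all vertices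
    too.\<close>
  have "edges H \<noteq> edges signed_petersen"
  proof
    assume eq: "edges H = edges signed_petersen"
    have "verts signed_petersen \<subseteq> (\<Union>e\<in>edges signed_petersen. set_uprod (fst e))"
    proof -
      have "{1..5} = {1, 2, 3, 4, 5 :: nat}" by auto
      then show ?thesis by (simp add: verts_petersen edges_petersen)
    qed
    also have "\<dots> \<subseteq> verts H"
      using H(1,4) by (force simp: signed_graph_def eq)
    finally show False using H(2) proper eq by auto
  qed
  then obtain e where e: "e \<in> edges signed_petersen" "e \<notin> edges H" using H(3) by auto
  obtain L where L: "\<And>x. \<bar>L x\<bar> \<in> {1, 2, 3 :: int}"
    "\<And>e'. e' \<in> edges signed_petersen - {e} \<Longrightarrow> compat_edge L e'"
    using petersen_delete_edge_labelling[OF e(1)] by blast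
  show "hom_exists H C3star"
  proof (rule hom_C3star_if_labelling[OF H(1) L(1)])
    fix e' assume e': "e' \<in> edges H"
    with H(3) e have "compat_edge L e'" by (intro L(2)) auto
    with H(4)[OF e'] show "\<exists>x y. ends H e' = Upair x y \<and> compat (sign H e') (L x) (L y)"
      by (simp add: compat_edge_def)
  qed
qed

end
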